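(* Consider the LPE-BC with COF with $K=2$ users and $Q\ge1$ layers, and assume $\Pr[M\ge q]>0$ and $\mathbb{E}[N_u]>0$ for all $q\in\{1,\dots,Q\}$, $u\in\{1,2\}$. For nonnegative reals $k_{u,q}$ ($u\in\{1,2\}$, $q\in\{1,\dots,Q\}$) define $t^{\rm unc}_q=\frac{k_{1,q}+k_{2,q}}{\Pr[M\ge q]}$, $t^{\rm unc}=\max_{q}t^{\rm unc}_q$, $k^{\rm rem}_{u,q}=k_{u,q}\big(1-\frac{\Pr[N_u\ge q]}{\Pr[M\ge q]}\big)$, $k^{\rm rem}_u=\Big[\sum_{q=1}^{Q}\big(k^{\rm rem}_{u,q}-(t^{\rm unc}-t^{\rm unc}_q)\Pr[N_u\ge q]\big)\Big]^+$, $t^{\rm NC}_u=k^{\rm rem}_u/\mathbb{E}[N_u]$ and $t^{\rm NC}=\max_{u\in\{1,2\}}t^{\rm NC}_u$. Then the region $$\mathcal{C}^{\rm in}=\bigcup_{t>0,\;k_{u,q}\ge0}\Big\{(R_1,R_2):\ t^{\rm unc}+t^{\rm NC}\le t,\ R_u=\tfrac{1}{t}\textstyle\sum_{q=1}^{Q}k_{u,q},\ u\in\{1,2\}\Big\}$$ is achievable, i.e. contained in the capacity region.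
   Context: LPE-BC with COF: fix integers $K$ (users) and $Q$ (layers) and a finite field $\mathcal{X}$. In each slot $t$ the transmitter sends $X_t=(X_{1,t},\dots,X_{Q,t})\in\mathcal{X}^Q$; a random state $N_t=(N_{1,t},\dots,N_{K,t})\in\{0,\dots,Q\}^K$, i.i.d. across slots with arbitrary fixed joint law of $(N_1,\dots,N_K)$, gives user $k$ the output $Y_{k,t}=(X_{1,t},\dots,X_{N_{k,t},t})$ (an erasure symbol if $N_{k,t}=0$). A length-$n$ code with rates $(R_1,\dots,R_K)$ (packets per slot) has independent uniform messages $W_k$ with $|\mathcal{X}|^{nR_k}$ values, encoders $X_t=f_t(W_1,\dots,W_K,N_1,\dots,N_{t-1})$ (feedback), and decoders $\hat W_k=\mathrm{dec}_k(Y_k^n,N_1,\dots,N_n)$; a rate tuple is achievable if error probability $\Pr[\exists k:\hat W_k\ne W_k]\to0$; the capacity region is the convex closure of achievable tuples (the field $\mathcal{X}$ may be taken as large as needed). Notation: $M:=\max(N_1,N_2)$, $[x]^+=\max(0,x)$. *)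

theory Defs
  imports "HOL-Probability.Probability" "HOL-Computational_Algebra.Primes"
begin

text \<open>Users are indexed by a finite type 'k (K = CARD('k)).  A channel state is a
vector N :: nat ^ 'k (N $ u = number of layers received by user u), drawn i.i.d.
per slot from the pmf P.  The alphabet is {0..<qf} (qf = field size, a prime power);
a transmitted slot symbol X_t is a list of length Q (one symbol per layer).\<close>

fun iid_pmf :: "'a pmf \<Rightarrow> nat \<Rightarrow> 'a list pmf" where
  "iid_pmf P 0 = return_pmf []"
| "iid_pmf P (Suc n) = bind_pmf P (\<lambda>x. map_pmf (Cons x) (iid_pmf P n))"

definition prime_power :: "nat \<Rightarrow> bool" where
  "prime_power q \<longleftrightarrow> (\<exists>p m. prime p \<and> m \<ge> 1 \<and> q = p ^ m)"

definition msize :: "nat \<Rightarrow> nat \<Rightarrow> real \<Rightarrow> nat" where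
  "msize qf n r = max 1 (nat \<lfloor>real qf powr (real n * r)\<rfloor>)"

definition msgs :: "nat \<Rightarrow> nat \<Rightarrow> real ^ 'k \<Rightarrow> (nat ^ 'k) set" where
  "msgs qf n R = {w. \<forall>u. w $ u < msize qf n (R $ u)}"

text \<open>Encoder: enc t w ss = X_t, where ss = list of the past states N_1..N_{t-1}
(feedback).  Decoder of user u: dec u ys ss, with ys the outputs Y_u^n and ss all states.\<close>
definition is_code ::
  "nat \<Rightarrow> nat \<Rightarrow> nat \<Rightarrow> real ^ 'k \<Rightarrow> (nat \<Rightarrow> nat ^ 'k \<Rightarrow> (nat ^ 'k) list \<Rightarrow> nat list) \<Rightarrow> bool" where
  "is_code qf Q n R enc \<longleftrightarrow>
     (\<forall>t<n. \<forall>w \<in> msgs qf n R. \<forall>ss. length (enc t w ss) = Q \<and> set (enc t w ss) \<subseteq> {..<qf})"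

definition user_output ::
  "nat \<Rightarrow> (nat \<Rightarrow> nat ^ 'k \<Rightarrow> (nat ^ 'k) list \<Rightarrow> nat list) \<Rightarrow> 'k \<Rightarrow> nat ^ 'k \<Rightarrow> (nat ^ 'k) list
     \<Rightarrow> nat list list" where
  "user_output n enc u w ss = map (\<lambda>t. take (ss ! t $ u) (enc t w (take t ss))) [0..<n]"

definition err_prob ::
  "(nat ^ 'k) pmf \<Rightarrow> nat \<Rightarrow> nat \<Rightarrow> real ^ 'k \<Rightarrow> (nat \<Rightarrow> nat ^ 'k \<Rightarrow> (nat ^ 'k) list \<Rightarrow> nat list)
     \<Rightarrow> ('k \<Rightarrow> nat list list \<Rightarrow> (nat ^ 'k) list \<Rightarrow> nat) \<Rightarrow> real" where
  "err_prob P qf n R enc dec =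
     measure_pmf.prob (pair_pmf (pmf_of_set (msgs qf n R)) (iid_pmf P n))
       {(w, ss). \<exists>u. dec u (user_output n enc u w ss) ss \<noteq> w $ u}"

definition achievable :: "(nat ^ 'k) pmf \<Rightarrow> nat \<Rightarrow> real ^ 'k \<Rightarrow> bool" where
  "achievable P Q R \<longleftrightarrow>
     (\<exists>qf. prime_power qf \<and>
        (\<exists>enc dec. (\<forall>n. is_code qf Q n R (enc n)) \<and>
           (\<lambda>n. err_prob P qf n R (enc n) (dec n)) \<longlonglongrightarrow> 0))"

definition capacity_region :: "(nat ^ 'k) pmf \<Rightarrow> nat \<Rightarrow> (real ^ 'k) set" where
  "capacity_region P Q = closure (convex hull {R. achievable P Q R})"

definition pM :: "(nat ^ 2) pmf \<Rightarrow> nat \<Rightarrow> real" where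
  "pM P q = measure_pmf.prob P {N. q \<le> max (N $ 1) (N $ 2)}"

definition pN :: "(nat ^ 2) pmf \<Rightarrow> 2 \<Rightarrow> nat \<Rightarrow> real" where
  "pN P u q = measure_pmf.prob P {N. q \<le> N $ u}"

definition EN :: "(nat ^ 2) pmf \<Rightarrow> 2 \<Rightarrow> real" where
  "EN P u = measure_pmf.expectation P (\<lambda>N. real (N $ u))"

definition t_unc_q :: "(nat ^ 2) pmf \<Rightarrow> (2 \<Rightarrow> nat \<Rightarrow> real) \<Rightarrow> nat \<Rightarrow> real" where
  "t_unc_q P k q = (k 1 q + k 2 q) / pM P q"

definition t_unc :: "(nat ^ 2) pmf \<Rightarrow> nat \<Rightarrow> (2 \<Rightarrow> nat \<Rightarrow> real) \<Rightarrow> real" where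
  "t_unc P Q k = Max (t_unc_q P k ` {1..Q})"

definition k_rem_q :: "(nat ^ 2) pmf \<Rightarrow> (2 \<Rightarrow> nat \<Rightarrow> real) \<Rightarrow> 2 \<Rightarrow> nat \<Rightarrow> real" where
  "k_rem_q P k u q = k u q * (1 - pN P u q / pM P q)"

definition k_rem :: "(nat ^ 2) pmf \<Rightarrow> nat \<Rightarrow> (2 \<Rightarrow> nat \<Rightarrow> real) \<Rightarrow> 2 \<Rightarrow> real" where
  "k_rem P Q k u = max 0 (\<Sum>q=1..Q. k_rem_q P k u q - (t_unc P Q k - t_unc_q P k q) * pN P u q)"

definition t_NC_u :: "(nat ^ 2) pmf \<Rightarrow> nat \<Rightarrow> (2 \<Rightarrow> nat \<Rightarrow> real) \<Rightarrow> 2 \<Rightarrow> real" where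
  "t_NC_u P Q k u = k_rem P Q k u / EN P u"

definition t_NC :: "(nat ^ 2) pmf \<Rightarrow> nat \<Rightarrow> (2 \<Rightarrow> nat \<Rightarrow> real) \<Rightarrow> real" where
  "t_NC P Q k = max (t_NC_u P Q k 1) (t_NC_u P Q k 2)"

definition C_in :: "(nat ^ 2) pmf \<Rightarrow> nat \<Rightarrow> (real ^ 2) set" where
  "C_in P Q = (\<Union>t \<in> {t. t > 0}. \<Union>k \<in> {k. \<forall>u q. 0 \<le> k u q}.
      {R. t_unc P Q k + t_NC P Q k \<le> t \<and> (\<forall>u. R $ u = (\<Sum>q=1..Q. k u q) / t)})"

end

theory Submission
  imports Defs
begin

text \<open>Random coding over the binary field. In every slot, each layer \<open>q\<close> independently carries, with
  probability \<open>\<alpha> u q = k u q / (pM P q * t)\<close>, a fresh random codeword bit of user \<open>u\<close>, and otherwise the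
  sum of two random hashes, one for each user \<open>u\<close>, of all bits of user \<open>u\<close> that so far only the
  other user has received. A user knows the hash input of the other user and can cancel it. No
  phases and no retransmissions are needed, so the scheme is stationary.

  A wrong message of user \<open>u\<close> stays consistent with the received bits first until its overheard
  history deviates from the true one, which costs a factor \<open>1/2\<close> for each codeword bit seen by any
  user, and afterwards costs a factor \<open>1/2\<close> for each codeword bit or hash received by user \<open>u\<close>.
  Bounding \<open>min 1 x \<le> x powr s\<close> with small \<open>s > 0\<close> (Gallager) makes the union bound decay as soon as
  both mean numbers of such bits per slot exceed the rate. The first mean equals
  \<open>(\<Sum>q. k u q) / t\<close>, and the second is at least that if and only if
  \<open>(\<Sum>q=1..Q. k_rem_q P k u q - (t_unc P Q k - t_unc_q P k q) * pN P u q) \<le> (t - t_unc P Q k) * EN P u\<close>.\<close>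

subsection \<open>Exponents and i.i.d. sequences\<close>

text \<open>After writing the left side as
  \<open>x * (x + y) powr (s - 1) + y * (x + y) powr (s - 1)\<close>, replacing \<open>x + y\<close>
  by the smaller \<open>x\<close> or \<open>y\<close> only increases the powers, because
  \<open>s - 1\<close> is not positive.\<close>

lemma powr_add_subadditive:
  fixes x y s :: real
  assumes "x \<ge> 0" "y \<ge> 0" "0 < s" "s \<le> 1"
  shows "(x + y) powr s \<le> x powr s + y powr s"
proof (cases "x = 0 \<or> y = 0")
  case False
  then have pos: "x > 0" "y > 0" using assms by auto
  have "(x + y) powr s = x * (x + y) powr (s - 1) + y * (x + y) powr (s - 1)"
    using pos by (simp add: powr_mult_base flip: distrib_right)
  also have "\<dots> \<le> x * x powr (s - 1) + y * y powr (s - 1)"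
    using pos assms by (intro add_mono mult_left_mono powr_mono2') auto
  also have "\<dots> = x powr s + y powr s"
    using pos by (simp add: powr_mult_base)
  finally show ?thesis .
qed (use assms in auto)

lemma min_1_le_powr:
  fixes x s :: real
  assumes "x \<ge> 0" "0 < s" "s \<le> 1"
  shows "min 1 x \<le> x powr s"
proof (cases "x \<le> 1")
  case True
  then show ?thesis
    using powr_mono'[of s 1 x] assms by simp
next
  case False
  then show ?thesis
    using ge_one_powr_ge_zero[of x s] assms by simp
qed

text \<open>The mean of \<open>2 powr (s * (R - X))\<close> is a finite sum of exponentials in
  \<open>s\<close> with value 1 and negative derivative at 0, so it is below 1 for small
  \<open>s > 0\<close>. This turns a mean number of bits into an error exponent.\<close>

lemma expectation_powr_eventually_less:
  fixes p :: "'a pmf" and X :: "'a \<Rightarrow> nat" and R :: real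
  assumes fin: "finite (set_pmf p)"
    and R: "R < measure_pmf.expectation p (\<lambda>x. real (X x))"
  shows "eventually (\<lambda>s. measure_pmf.expectation p (\<lambda>x. ((1/2) ^ X x) powr s) < 2 powr (- s * R)) (at_right 0)"
proof -
  define f where "f s = (\<Sum>x\<in>set_pmf p. pmf p x * 2 powr (s * (R - real (X x))))" for s
  have "((\<lambda>s. \<Sum>x\<in>set_pmf p. pmf p x * 2 powr (s * (R - real (X x)))) has_real_derivative
      (\<Sum>x\<in>set_pmf p. pmf p x * ((R - real (X x)) * ln 2))) (at 0)"
    by (auto intro!: derivative_eq_intros sum.cong)
  moreover have "(\<Sum>x\<in>set_pmf p. pmf p x * ((R - real (X x)) * ln 2)) =
      (R - measure_pmf.expectation p (\<lambda>x. real (X x))) * ln 2"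
  proof -
    have "(\<Sum>x\<in>set_pmf p. pmf p x * ((R - real (X x)) * ln 2)) =
        (R * sum (pmf p) (set_pmf p) - (\<Sum>x\<in>set_pmf p. real (X x) * pmf p x)) * ln 2"
      by (simp add: algebra_simps sum_subtractf sum_distrib_left)
    then show ?thesis
      using sum_pmf_eq_1[OF fin order_refl] by (simp add: integral_measure_pmf_real[OF fin])
  qed
  ultimately have "(f has_real_derivative (R - measure_pmf.expectation p (\<lambda>x. real (X x))) * ln 2) (at 0)"
    by (simp add: f_def[abs_def])
  moreover have "(R - measure_pmf.expectation p (\<lambda>x. real (X x))) * ln 2 < 0"
    using R by (simp add: mult_less_0_iff)
  ultimately obtain d where d: "d > 0" "\<And>h. h > 0 \<Longrightarrow> h < d \<Longrightarrow> f h < f 0"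
    using DERIV_neg_dec_right[of f _ 0] by auto
  have f0: "f 0 = 1"
    using sum_pmf_eq_1[OF fin order_refl] by (simp add: f_def)
  have "((1/2) ^ k) powr s = 2 powr (s * (R - real k)) * 2 powr (- s * R)" for k s
  proof -
    have "((1/2) ^ k :: real) = 2 powr (- real k)"
      by (simp add: powr_minus powr_realpow power_divide divide_simps)
    then show ?thesis
      by (simp add: powr_powr algebra_simps flip: powr_add)
  qed
  then have "measure_pmf.expectation p (\<lambda>x. ((1/2) ^ X x) powr s) = f s * 2 powr (- s * R)" for s
    by (subst integral_measure_pmf_real[OF fin]) (auto simp: f_def sum_distrib_left mult_ac)
  moreover have "f s < 1" if "s > 0" "s < d" for s
    using d(2)[of s] that f0 by simp
  ultimately show ?thesis
    using d(1) by (auto simp: eventually_at_right_field intro!: exI[of _ d])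
qed

section \<open>Products of i.i.d. sequences and derandomization\<close>

text \<open>States come from the channel and schedules from the code, but the error analysis treats
  each pair as one slot of a single i.i.d. sequence.\<close>

lemma iid_pmf_zip:
  "map_pmf (\<lambda>(xs, ys). zip xs ys) (pair_pmf (iid_pmf p n) (iid_pmf r n)) = iid_pmf (pair_pmf p r) n"
proof (induction n)
  case (Suc n)
  have "map_pmf (\<lambda>(xs, ys). zip xs ys) (pair_pmf (iid_pmf p (Suc n)) (iid_pmf r (Suc n)))
    = bind_pmf p (\<lambda>x. bind_pmf (iid_pmf p n) (\<lambda>xs. bind_pmf r (\<lambda>y. map_pmf (\<lambda>ys. (x, y) # zip xs ys) (iid_pmf r n))))"
    by (simp add: pair_pmf_def map_bind_pmf bind_assoc_pmf bind_map_pmf map_pmf_def bind_return_pmf)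
  also have "\<dots> = bind_pmf p (\<lambda>x. bind_pmf r (\<lambda>y. bind_pmf (iid_pmf p n) (\<lambda>xs. map_pmf (\<lambda>ys. (x, y) # zip xs ys) (iid_pmf r n))))"
    by (intro bind_pmf_cong refl bind_commute_pmf)
  also have "\<dots> = iid_pmf (pair_pmf p r) (Suc n)"
    unfolding iid_pmf.simps Suc[symmetric]
    by (simp add: pair_pmf_def map_bind_pmf bind_assoc_pmf bind_map_pmf map_pmf_def bind_return_pmf)
  finally show ?case .
qed (simp add: pair_pmf_def bind_return_pmf)

lemma length_iid_pmf: "xs \<in> set_pmf (iid_pmf p n) \<Longrightarrow> length xs = n"
  by (induction n arbitrary: xs) auto

lemma emeasure_pair_pmf:
  "emeasure (measure_pmf (pair_pmf p r)) S = (\<integral>\<^sup>+x. emeasure (measure_pmf r) {y. (x, y) \<in> S} \<partial>measure_pmf p)"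
  unfolding pair_pmf_def by (simp add: vimage_def flip: map_pmf_def)

text \<open>If every \<open>c\<close> in the support exceeded \<open>e\<close>, so would the mean.
  This extracts one fixed code from a random ensemble.\<close>

lemma pair_pmf_exists_le:
  assumes "measure_pmf.prob (pair_pmf C X) {(c, x). B c x} \<le> e"
  shows "\<exists>c \<in> set_pmf C. measure_pmf.prob X {x. B c x} \<le> e"
proof (rule ccontr)
  assume "\<not> ?thesis"
  then have *: "measure_pmf.prob X {x. B c x} > e" if "c \<in> set_pmf C" for c
    using that by (auto simp: not_le)
  have "e \<ge> 0" using assms measure_nonneg order_trans by blast
  let ?f = "\<lambda>c. measure_pmf.prob X {x. B c x}"
  have eq: "emeasure (measure_pmf (pair_pmf C X)) {(c, x). B c x} = (\<integral>\<^sup>+c. ennreal (?f c) \<partial>measure_pmf C)"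
    unfolding emeasure_pair_pmf by (simp add: measure_pmf.emeasure_eq_measure)
  have int: "integrable (measure_pmf C) ?f"
    by (rule measure_pmf.integrable_const_bound[where B = 1]) auto
  have "measure_pmf.prob (pair_pmf C X) {(c, x). B c x} = measure_pmf.expectation C ?f"
    using eq by (subst (asm) nn_integral_eq_integral[OF int])
      (auto simp: measure_pmf.emeasure_eq_measure)
  moreover have "measure_pmf.expectation C (\<lambda>c. e) < measure_pmf.expectation C ?f"
    by (rule measure_pmf.integral_less_AE_space) (use int * in \<open>auto simp: AE_measure_pmf_iff measure_pmf.emeasure_space_1\<close>)
  ultimately show False using assms by simp
qed

subsection \<open>Consistency of a wrong message\<close>

text \<open>A table holds the random bits of one slot: a key belongs to it iff its bit is 1.
  \<open>Inl\<close> keys address codeword bits by message, \<open>Inr\<close> keys hash bits by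
  overheard history. A history stores, for each past slot, the layers whose overheard bit is 1;
  which layers were overheard at all is fixed by the slot.\<close>

type_synonym schedule = "nat \<Rightarrow> 2 option"
type_synonym slot = "(nat ^ 2) \<times> schedule"
type_synonym key = "2 \<times> nat \<times> (nat + nat set list)"
type_synonym table = "key set"

text \<open>Flipping membership of \<open>b q\<close> is an involution that negates the equation at
  \<open>q\<close> and preserves the others, since \<open>b q\<close> differs from every other key
  involved. Each equation thus halves the number of tables.\<close>

lemma prob_agree:
  assumes "finite D" "finite S" and "\<And>q. q \<in> S \<Longrightarrow> b q \<in> D"
    and "\<And>q. q \<in> S \<Longrightarrow> b q \<noteq> b' q"
    and "\<And>q r. q \<in> S \<Longrightarrow> r \<in> S \<Longrightarrow> q \<noteq> r \<Longrightarrow> b q \<noteq> b r \<and> b q \<noteq> b' r"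
  shows "measure_pmf.prob (pmf_of_set (Pow D)) {G. \<forall>q\<in>S. b q \<in> G \<longleftrightarrow> b' q \<in> G} = (1/2) ^ card S"
proof -
  define A where "A S = {G \<in> Pow D. \<forall>q\<in>S. b q \<in> G \<longleftrightarrow> b' q \<in> G}" for S
  have fin: "finite (A S)" for S
    using assms(1) by (simp add: A_def)
  have "card (A S) * 2 ^ card S = 2 ^ card D"
    using assms(2-)
  proof (induction S rule: finite_induct)
    case empty
    then show ?case using assms(1) by (simp add: A_def card_Pow flip: Pow_def)
  next
    case (insert q S)
    let ?B = "{G \<in> A S. (b q \<in> G) \<noteq> (b' q \<in> G)}"
    define f where "f G = (if b q \<in> G then G - {b q} else insert (b q) G)" for G
    have ff: "f (f G) = G" for G
      by (auto simp: f_def)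
    have memf: "x \<in> f G \<longleftrightarrow> (if x = b q then x \<notin> G else x \<in> G)" for x G
      by (auto simp: f_def)
    have fA: "f G \<in> A S" if "G \<in> A S" for G
    proof -
      have "f G \<subseteq> D"
        using that insert.prems(1)[of q] by (auto simp: f_def A_def)
      moreover have "b r \<in> f G \<longleftrightarrow> b' r \<in> f G" if "r \<in> S" for r
      proof -
        have "b r \<noteq> b q" "b' r \<noteq> b q"
          using insert.prems(3)[of q r] that insert.hyps(2) by (metis insertI1 insertI2)+
        then show ?thesis using \<open>G \<in> A S\<close> that by (simp add: memf A_def)
      qed
      ultimately show ?thesis by (simp add: A_def)
    qed
    have bq: "b q \<noteq> b' q" using insert.prems(2) by simp
    have ins: "A (insert q S) = {G \<in> A S. (b q \<in> G) = (b' q \<in> G)}"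
      by (auto simp: A_def)
    have "bij_betw f (A (insert q S)) ?B"
      by (rule bij_betwI[where g = f]) (use bq in \<open>auto simp: ins fA ff memf\<close>)
    then have "card (A (insert q S)) = card ?B"
      by (rule bij_betw_same_card)
    moreover have "card (A S) = card (A (insert q S)) + card ?B"
      by (subst card_Un_disjoint[symmetric]) (auto simp: ins fin intro!: arg_cong[where f = card])
    moreover have "card (A S) * 2 ^ card S = 2 ^ card D"
      using insert.prems by (intro insert.IH) auto
    ultimately show ?case using insert.hyps by (simp add: algebra_simps)
  qed
  then have "real (card (A S)) * 2 ^ card S = 2 ^ card D"
    by (metis of_nat_mult of_nat_numeral of_nat_power)
  moreover have "Pow D \<inter> {G. \<forall>q\<in>S. b q \<in> G \<longleftrightarrow> b' q \<in> G} = A S"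
    by (auto simp: A_def)
  ultimately show ?thesis
    using assms(1) by (subst measure_pmf_of_set) (auto simp: card_Pow field_simps)
qed

text \<open>User \<open>u + 1\<close> is the other user. In type \<open>2\<close> the schedule entry \<open>Some u\<close> stands for an
  uncoded bit of user \<open>u\<close>, \<open>None\<close> for a network-coded bit.\<close>

definition overheard :: "nat \<Rightarrow> 2 \<Rightarrow> slot \<Rightarrow> table \<Rightarrow> nat \<Rightarrow> nat set" where
  "overheard Q u x G a = {q \<in> {1..Q}. snd x q = Some u \<and> fst x $ u < q \<and> q \<le> fst x $ (u + 1)
     \<and> (u, q, Inl a) \<in> G}"

text \<open>User \<open>u\<close> can cancel the hash of the other user, so on a network-coded layer
  only the hash of \<open>u\<close> has to match. Each candidate message produces its own history,
  hence \<open>h\<close> and \<open>h'\<close>.\<close>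

definition indist :: "nat \<Rightarrow> 2 \<Rightarrow> slot \<Rightarrow> table \<Rightarrow> nat \<Rightarrow> nat \<Rightarrow> nat set list \<Rightarrow> nat set list \<Rightarrow> bool" where
  "indist Q u x G a a' h h' \<longleftrightarrow> (\<forall>q\<in>{1..Q}. q \<le> fst x $ u \<longrightarrow>
     (snd x q = Some u \<longrightarrow> ((u, q, Inl a) \<in> G \<longleftrightarrow> (u, q, Inl a') \<in> G)) \<and>
     (snd x q = None \<longrightarrow> ((u, q, Inr h) \<in> G \<longleftrightarrow> (u, q, Inr h') \<in> G)))"

fun indists :: "nat \<Rightarrow> 2 \<Rightarrow> nat \<Rightarrow> nat \<Rightarrow> nat set list \<Rightarrow> nat set list \<Rightarrow> slot list \<Rightarrow> table list \<Rightarrow> bool" where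
  "indists Q u a a' h h' (x # xs) (G # Gs) \<longleftrightarrow> indist Q u x G a a' h h' \<and>
     indists Q u a a' (h @ [overheard Q u x G a]) (h' @ [overheard Q u x G a']) xs Gs"
| "indists Q u a a' h h' _ _ \<longleftrightarrow> True"

definition seen :: "nat \<Rightarrow> 2 \<Rightarrow> slot \<Rightarrow> nat" where
  "seen Q u x = card {q \<in> {1..Q}. snd x q = Some u \<and> (q \<le> fst x $ u \<or> q \<le> fst x $ (u + 1))}"

definition useful :: "nat \<Rightarrow> 2 \<Rightarrow> slot \<Rightarrow> nat" where
  "useful Q u x = card {q \<in> {1..Q}. (snd x q = Some u \<or> snd x q = None) \<and> q \<le> fst x $ u}"

definition hprod :: "nat \<Rightarrow> 2 \<Rightarrow> slot list \<Rightarrow> real" where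
  "hprod Q u xs = (\<Prod>x\<leftarrow>xs. (1/2) ^ useful Q u x)"

text \<open>\<open>hprod\<close> bounds the consistency probability once the histories differ; in the recursion of
  \<open>conf_bound\<close> it is the contribution of the runs whose histories separate in the first slot.\<close>

fun conf_bound :: "nat \<Rightarrow> 2 \<Rightarrow> slot list \<Rightarrow> real" where
  "conf_bound Q u [] = 1"
| "conf_bound Q u (x # xs) = (1/2) ^ seen Q u x * conf_bound Q u xs + hprod Q u xs"

text \<open>Only finitely many messages and histories occur within \<open>n\<close> slots; this
  finiteness permits a uniformly random table.\<close>

definition keys :: "nat \<Rightarrow> nat \<Rightarrow> nat \<Rightarrow> key set" where
  "keys Q m n = UNIV \<times> {1..Q} \<times> (Inl ` {..<m} \<union> Inr ` {h. set h \<subseteq> Pow {1..Q} \<and> length h \<le> n})"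

lemma finite_keys: "finite (keys Q m n)"
  by (auto simp: keys_def finite_lists_length_le)

lemma overheard_subset: "overheard Q u x G a \<subseteq> {1..Q}"
  by (auto simp: overheard_def)

lemma hprod_simps [simp]: "hprod Q u [] = 1" "hprod Q u (x # xs) = (1/2) ^ useful Q u x * hprod Q u xs"
  by (simp_all add: hprod_def)

lemma hprod_nonneg: "hprod Q u xs \<ge> 0"
  by (induction xs) auto

lemma conf_bound_nonneg: "conf_bound Q u xs \<ge> 0"
  by (induction xs) (auto simp: hprod_nonneg)

section \<open>Confusion probability for fixed slots\<close>

text \<open>Different messages read different \<open>Inl\<close> keys and different histories
  different \<open>Inr\<close> keys, so each useful layer imposes one independent fair
  equation.\<close>

lemma prob_indist:
  assumes "finite D" "keys Q m n \<subseteq> D" and "a < m" "a' < m" "a \<noteq> a'" "h \<noteq> h'"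
    and "set h \<subseteq> Pow {1..Q}" "set h' \<subseteq> Pow {1..Q}" "length h \<le> n" "length h' \<le> n"
  shows "measure_pmf.prob (pmf_of_set (Pow D)) {G. indist Q u x G a a' h h'} = (1/2) ^ useful Q u x"
proof -
  let ?S = "{q \<in> {1..Q}. (snd x q = Some u \<or> snd x q = None) \<and> q \<le> fst x $ u}"
  let ?b = "\<lambda>a h q. (u, q, if snd x q = None then Inr h else Inl a)"
  have "{G. indist Q u x G a a' h h'} = {G. \<forall>q\<in>?S. ?b a h q \<in> G \<longleftrightarrow> ?b a' h' q \<in> G}"
    unfolding indist_def by auto
  moreover have "?b a h q \<in> D" if "q \<in> ?S" for q
    using assms that by (auto simp: keys_def)
  ultimately show ?thesis
    using assms(1,5,6) unfolding useful_def by (simp only:, intro prob_agree) auto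
qed

text \<open>With equal histories the hash bits agree automatically. Uncoded bits received by
  \<open>u\<close> must match for indistinguishability, and those received by the other user alone
  must match to keep the histories equal.\<close>

lemma prob_indist_same:
  assumes "finite D" "keys Q m n \<subseteq> D" and "a < m" "a' < m" "a \<noteq> a'"
  shows "measure_pmf.prob (pmf_of_set (Pow D))
    {G. indist Q u x G a a' h h \<and> overheard Q u x G a = overheard Q u x G a'} = (1/2) ^ seen Q u x"
proof -
  let ?S = "{q \<in> {1..Q}. snd x q = Some u \<and> (q \<le> fst x $ u \<or> q \<le> fst x $ (u + 1))}"
  let ?b = "\<lambda>a q. (u, q, Inl a)"
  have "{G. indist Q u x G a a' h h \<and> overheard Q u x G a = overheard Q u x G a'} =
      {G. \<forall>q\<in>?S. ?b a q \<in> G \<longleftrightarrow> ?b a' q \<in> G}"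
  proof -
    have ov: "overheard Q u x G a = overheard Q u x G a' \<longleftrightarrow> (\<forall>q\<in>{1..Q}. snd x q = Some u \<longrightarrow>
        fst x $ u < q \<longrightarrow> q \<le> fst x $ (u + 1) \<longrightarrow> (?b a q \<in> G \<longleftrightarrow> ?b a' q \<in> G))" for G
      unfolding overheard_def by blast
    have ind: "indist Q u x G a a' h h \<longleftrightarrow>
        (\<forall>q\<in>{1..Q}. snd x q = Some u \<longrightarrow> q \<le> fst x $ u \<longrightarrow> (?b a q \<in> G \<longleftrightarrow> ?b a' q \<in> G))" for G
      unfolding indist_def by blast
    have lin: "q \<le> fst x $ u \<or> fst x $ u < q" for q
      by linarith
    have "indist Q u x G a a' h h \<and> overheard Q u x G a = overheard Q u x G a' \<longleftrightarrow>
        (\<forall>q\<in>?S. ?b a q \<in> G \<longleftrightarrow> ?b a' q \<in> G)" for G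
      unfolding ov ind using lin by blast
    then show ?thesis by blast
  qed
  moreover have "?b a q \<in> D" if "q \<in> ?S" for q
    using assms that by (auto simp: keys_def)
  ultimately show ?thesis
    using assms(1,5) unfolding seen_def by (simp only:, intro prob_agree) auto
qed

lemma iid_pmf_Suc_emeasure:
  "emeasure (measure_pmf (iid_pmf p (Suc n))) S = (\<integral>\<^sup>+x. emeasure (measure_pmf (iid_pmf p n)) {xs. x # xs \<in> S} \<partial>measure_pmf p)"
  by (simp add: vimage_def)

text \<open>Histories that differ still differ after further entries, so \<open>prob_indist\<close>
  applies in each slot, and the tables of different slots are independent. The length conditions
  keep both histories inside \<open>keys\<close>.\<close>

lemma prob_indists_diff:
  assumes "finite D" "keys Q m n \<subseteq> D" and "a < m" "a' < m" "a \<noteq> a'" "h \<noteq> h'" "length h = length h'"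
    and "set h \<subseteq> Pow {1..Q}" "set h' \<subseteq> Pow {1..Q}" "length h + length xs \<le> n"
  shows "emeasure (measure_pmf (iid_pmf (pmf_of_set (Pow D)) (length xs))) {Gs. indists Q u a a' h h' xs Gs}
    \<le> ennreal (hprod Q u xs)"
  using assms(6-)
proof (induction xs arbitrary: h h')
  case Nil
  then show ?case by (simp add: measure_pmf.emeasure_eq_measure)
next
  case (Cons x xs)
  let ?G = "pmf_of_set (Pow D)"
  let ?I = "iid_pmf ?G (length xs)"
  let ?A = "{G. indist Q u x G a a' h h'}"
  have "emeasure (measure_pmf (iid_pmf ?G (length (x # xs)))) {Gs. indists Q u a a' h h' (x # xs) Gs}
    = (\<integral>\<^sup>+G. emeasure (measure_pmf ?I) {Gs. indists Q u a a' h h' (x # xs) (G # Gs)} \<partial>measure_pmf ?G)"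
    by (simp only: list.size iid_pmf_Suc_emeasure add_Suc_right add_0_right mem_Collect_eq)
  also have "\<dots> \<le> (\<integral>\<^sup>+G. ennreal (hprod Q u xs) * indicator ?A G \<partial>measure_pmf ?G)"
  proof (rule nn_integral_mono)
    fix G
    have "emeasure (measure_pmf ?I) {Gs. indists Q u a a' (h @ [overheard Q u x G a]) (h' @ [overheard Q u x G a']) xs Gs}
      \<le> ennreal (hprod Q u xs)"
      by (rule Cons.IH) (use Cons.prems overheard_subset in auto)
    then show "emeasure (measure_pmf ?I) {Gs. indists Q u a a' h h' (x # xs) (G # Gs)}
      \<le> ennreal (hprod Q u xs) * indicator ?A G"
      by (auto split: split_indicator)
  qed
  also have "\<dots> = ennreal (hprod Q u xs) * emeasure (measure_pmf ?G) ?A"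
    by (simp add: nn_integral_cmult)
  also have "\<dots> = ennreal (hprod Q u (x # xs))"
    using prob_indist[OF assms(1-5) Cons.prems(1), where u = u and x = x] Cons.prems
    by (simp add: measure_pmf.emeasure_eq_measure ennreal_mult' hprod_nonneg mult.commute)
  finally show ?case .
qed

text \<open>Split on whether the two messages have the same overheard bits in the first slot: if so,
  the induction hypothesis covers the remaining slots, otherwise \<open>prob_indists_diff\<close>
  does.\<close>

lemma prob_indists:
  assumes "finite D" "keys Q m n \<subseteq> D" and "a < m" "a' < m" "a \<noteq> a'"
    and "set h \<subseteq> Pow {1..Q}" "length h + length xs \<le> n"
  shows "emeasure (measure_pmf (iid_pmf (pmf_of_set (Pow D)) (length xs))) {Gs. indists Q u a a' h h xs Gs}
    \<le> ennreal (conf_bound Q u xs)"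
  using assms(6-)
proof (induction xs arbitrary: h)
  case Nil
  then show ?case by (simp add: measure_pmf.emeasure_eq_measure)
next
  case (Cons x xs)
  let ?G = "pmf_of_set (Pow D)"
  let ?I = "iid_pmf ?G (length xs)"
  let ?A = "{G. indist Q u x G a a' h h \<and> overheard Q u x G a = overheard Q u x G a'}"
  have "emeasure (measure_pmf (iid_pmf ?G (length (x # xs)))) {Gs. indists Q u a a' h h (x # xs) Gs}
    = (\<integral>\<^sup>+G. emeasure (measure_pmf ?I) {Gs. indists Q u a a' h h (x # xs) (G # Gs)} \<partial>measure_pmf ?G)"
    by (simp only: list.size iid_pmf_Suc_emeasure add_Suc_right add_0_right mem_Collect_eq)
  \<comment> \<open>The second summand has no indicator: when the histories separate, the
    probability for the first slot is simply bounded by 1.\<close>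
  also have "\<dots> \<le> (\<integral>\<^sup>+G. ennreal (conf_bound Q u xs) * indicator ?A G + ennreal (hprod Q u xs) \<partial>measure_pmf ?G)"
  proof (rule nn_integral_mono)
    fix G
    have *: "emeasure (measure_pmf ?I) {Gs. indists Q u a a' (h @ [overheard Q u x G a]) (h @ [overheard Q u x G a']) xs Gs}
      \<le> (if overheard Q u x G a = overheard Q u x G a' then ennreal (conf_bound Q u xs) else ennreal (hprod Q u xs))"
    proof (cases "overheard Q u x G a = overheard Q u x G a'")
      case True
      have "emeasure (measure_pmf ?I) {Gs. indists Q u a a' (h @ [overheard Q u x G a']) (h @ [overheard Q u x G a']) xs Gs}
        \<le> ennreal (conf_bound Q u xs)"
        by (rule Cons.IH) (use Cons.prems overheard_subset in auto)
      then show ?thesis using True by simp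
    next
      case False
      have "emeasure (measure_pmf ?I) {Gs. indists Q u a a' (h @ [overheard Q u x G a]) (h @ [overheard Q u x G a']) xs Gs}
        \<le> ennreal (hprod Q u xs)"
        by (rule prob_indists_diff[OF assms(1-5)]) (use Cons.prems overheard_subset False in auto)
      then show ?thesis using False by simp
    qed
    show "emeasure (measure_pmf ?I) {Gs. indists Q u a a' h h (x # xs) (G # Gs)}
      \<le> ennreal (conf_bound Q u xs) * indicator ?A G + ennreal (hprod Q u xs)"
      by (cases "indist Q u x G a a' h h") (auto intro!: order_trans[OF *])
  qed
  also have "\<dots> = ennreal (conf_bound Q u xs) * emeasure (measure_pmf ?G) ?A + ennreal (hprod Q u xs)"
    by (subst nn_integral_add) (auto simp: nn_integral_cmult)
  also have "\<dots> = ennreal (conf_bound Q u (x # xs))"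
    using prob_indist_same[OF assms(1-5), where u = u and x = x]
    by (simp add: measure_pmf.emeasure_eq_measure ennreal_mult' hprod_nonneg conf_bound_nonneg mult.commute)
  finally show ?case .
qed

section \<open>Averaging the confusion bound over random slots\<close>

lemma nn_integral_hprod:
  "(\<integral>\<^sup>+xs. ennreal (hprod Q u xs powr s) \<partial>measure_pmf (iid_pmf p n)) =
   (\<integral>\<^sup>+x. ennreal (((1/2) ^ useful Q u x) powr s) \<partial>measure_pmf p) ^ n"
proof (induction n)
  case (Suc n)
  then show ?case
    by (simp add: powr_mult hprod_nonneg ennreal_mult' nn_integral_cmult nn_integral_multc)
qed simp

text \<open>Subadditivity of the power turns the recursion of \<open>conf_bound\<close> into
  \<open>E (n + 1) \<le> \<rho> * E n + \<rho> ^ n\<close>, which the stated expression solves. The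
  linear factor reflects the possible slots of first separation.\<close>

lemma nn_integral_conf_bound:
  assumes "0 < s" "s \<le> 1" "0 < \<rho>"
    and A: "(\<integral>\<^sup>+x. ennreal (((1/2) ^ seen Q u x) powr s) \<partial>measure_pmf p) \<le> ennreal \<rho>"
    and B: "(\<integral>\<^sup>+x. ennreal (((1/2) ^ useful Q u x) powr s) \<partial>measure_pmf p) \<le> ennreal \<rho>"
  shows "(\<integral>\<^sup>+xs. ennreal (conf_bound Q u xs powr s) \<partial>measure_pmf (iid_pmf p n)) \<le> ennreal ((1 + n / \<rho>) * \<rho> ^ n)"
proof (induction n)
  case (Suc n)
  let ?a = "\<lambda>x. ((1/2) ^ seen Q u x) powr s"
  let ?A = "\<integral>\<^sup>+x. ennreal (?a x) \<partial>measure_pmf p"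
  let ?E = "\<integral>\<^sup>+xs. ennreal (conf_bound Q u xs powr s) \<partial>measure_pmf (iid_pmf p n)"
  let ?H = "\<integral>\<^sup>+xs. ennreal (hprod Q u xs powr s) \<partial>measure_pmf (iid_pmf p n)"
  have "conf_bound Q u (x # xs) powr s \<le> ?a x * conf_bound Q u xs powr s + hprod Q u xs powr s" for x xs
    using powr_add_subadditive[of "(1/2) ^ seen Q u x * conf_bound Q u xs" "hprod Q u xs" s] assms(1,2)
    by (simp add: powr_mult hprod_nonneg conf_bound_nonneg)
  then have "(\<integral>\<^sup>+xs. ennreal (conf_bound Q u xs powr s) \<partial>measure_pmf (iid_pmf p (Suc n))) \<le>
    (\<integral>\<^sup>+x. \<integral>\<^sup>+xs. ennreal (?a x) * ennreal (conf_bound Q u xs powr s) + ennreal (hprod Q u xs powr s)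
       \<partial>measure_pmf (iid_pmf p n) \<partial>measure_pmf p)"
    unfolding iid_pmf.simps nn_integral_bind_pmf nn_integral_map_pmf
    by (intro nn_integral_mono) (simp flip: ennreal_mult' ennreal_plus del: conf_bound.simps add: ennreal_leI)
  also have "\<dots> = ?A * ?E + ?H"
    by (simp add: nn_integral_add nn_integral_cmult nn_integral_multc)
  also have "\<dots> \<le> ennreal \<rho> * ennreal ((1 + n / \<rho>) * \<rho> ^ n) + ennreal \<rho> ^ n"
    unfolding nn_integral_hprod by (intro add_mono mult_mono Suc A power_mono B) auto
  also have "\<dots> = ennreal ((1 + Suc n / \<rho>) * \<rho> ^ Suc n)"
    using assms(3) by (simp add: ennreal_power field_simps flip: ennreal_mult' ennreal_plus)
  finally show ?case .
qed simp

text \<open>A union bound over the \<open>m - 1\<close> wrong messages for fixed slots, then an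
  average over slots. The tables are built for \<open>m'\<close> messages because both users share
  them while their message sets differ in size.\<close>

lemma prob_exists_confusable:
  assumes "0 < s" "s \<le> 1" "0 < \<rho>" "a < m" "m \<le> m'"
    and A: "(\<integral>\<^sup>+x. ennreal (((1/2) ^ seen Q u x) powr s) \<partial>measure_pmf p) \<le> ennreal \<rho>"
    and B: "(\<integral>\<^sup>+x. ennreal (((1/2) ^ useful Q u x) powr s) \<partial>measure_pmf p) \<le> ennreal \<rho>"
  shows "emeasure (measure_pmf (pair_pmf (iid_pmf p n) (iid_pmf (pmf_of_set (Pow (keys Q m' n))) n)))
      {(xs, Gs). \<exists>a'<m. a' \<noteq> a \<and> indists Q u a a' [] [] xs Gs}
    \<le> ennreal (real (m - 1) powr s * ((1 + n / \<rho>) * \<rho> ^ n))" (is "emeasure (measure_pmf (pair_pmf _ ?G)) _ \<le> _")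
proof -
  have *: "emeasure (measure_pmf ?G) {Gs. \<exists>a'<m. a' \<noteq> a \<and> indists Q u a a' [] [] xs Gs}
      \<le> ennreal (real (m - 1) powr s) * ennreal (conf_bound Q u xs powr s)" (is "emeasure _ ?S \<le> _")
    if "length xs = n" for xs
  proof -
    have "?S = (\<Union>a'\<in>{..<m} - {a}. {Gs. indists Q u a a' [] [] xs Gs})"
      by auto
    then have "emeasure (measure_pmf ?G) ?S \<le> (\<Sum>a'\<in>{..<m} - {a}. emeasure (measure_pmf ?G) {Gs. indists Q u a a' [] [] xs Gs})"
      by (simp add: emeasure_subadditive_finite)
    also have "\<dots> \<le> (\<Sum>a'\<in>{..<m} - {a}. ennreal (conf_bound Q u xs))"
      using prob_indists[OF finite_keys order_refl, where xs = xs and h = "[]" and n = n] that assms(4,5)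
      by (intro sum_mono) auto
    also have "\<dots> = ennreal (real (m - 1) * conf_bound Q u xs)"
      using assms(4) by (simp add: card_Diff_singleton ennreal_mult' conf_bound_nonneg ennreal_of_nat_eq_real_of_nat)
    \<comment> \<open>The cap at 1 is what admits the power \<open>s\<close>; it has to be applied
      for fixed slots, before averaging.\<close>
    finally have "measure_pmf.prob ?G ?S \<le> min 1 (real (m - 1) * conf_bound Q u xs)"
      by (simp add: measure_pmf.emeasure_eq_measure conf_bound_nonneg)
    also have "\<dots> \<le> (real (m - 1) * conf_bound Q u xs) powr s"
      using assms by (intro min_1_le_powr) (auto simp: conf_bound_nonneg)
    finally show ?thesis
      by (simp add: measure_pmf.emeasure_eq_measure powr_mult conf_bound_nonneg ennreal_leI flip: ennreal_mult')
  qed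
  have "emeasure (measure_pmf (pair_pmf (iid_pmf p n) ?G)) {(xs, Gs). \<exists>a'<m. a' \<noteq> a \<and> indists Q u a a' [] [] xs Gs}
    \<le> (\<integral>\<^sup>+xs. ennreal (real (m - 1) powr s) * ennreal (conf_bound Q u xs powr s) \<partial>measure_pmf (iid_pmf p n))"
    unfolding emeasure_pair_pmf
    by (intro nn_integral_mono_AE) (auto simp: AE_measure_pmf_iff length_iid_pmf simp del: One_nat_def intro!: *)
  also have "\<dots> \<le> ennreal (real (m - 1) powr s) * ennreal ((1 + n / \<rho>) * \<rho> ^ n)"
    using nn_integral_conf_bound[OF assms(1-3) A B, of n] by (simp add: nn_integral_cmult mult_left_mono)
  also have "\<dots> = ennreal (real (m - 1) powr s * ((1 + n / \<rho>) * \<rho> ^ n))"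
    using assms by (simp add: ennreal_mult')
  finally show ?thesis .
qed

subsection \<open>The code\<close>

definition history :: "nat \<Rightarrow> 2 \<Rightarrow> slot list \<Rightarrow> table list \<Rightarrow> nat \<Rightarrow> nat \<Rightarrow> nat set list" where
  "history Q u xs Gs a t = map (\<lambda>i. overheard Q u (xs ! i) (Gs ! i) a) [0..<t]"

text \<open>Links the recursive form, suited to induction on slots, with the slotwise form in which
  the encoder produces its bits.\<close>

lemma indists_iff:
  "length xs = length Gs \<Longrightarrow> indists Q u a a' h h' xs Gs \<longleftrightarrow> (\<forall>t<length xs.
     indist Q u (xs ! t) (Gs ! t) a a' (h @ history Q u xs Gs a t) (h' @ history Q u xs Gs a' t))"
proof (induction xs Gs arbitrary: h h' rule: list_induct2)
  case (Cons x xs G Gs)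
  then show ?case
    by (simp add: history_def All_less_Suc2 map_upt_Suc del: upt_Suc)
qed simp

text \<open>Inequality of truth values serves as addition in the binary field.\<close>

definition coded_bit :: "schedule \<Rightarrow> table \<Rightarrow> nat ^ 2 \<Rightarrow> (2 \<Rightarrow> nat set list) \<Rightarrow> nat \<Rightarrow> bool" where
  "coded_bit f G w H q = (case f q of Some u \<Rightarrow> (u, q, Inl (w $ u)) \<in> G
     | None \<Rightarrow> ((1, q, Inr (H 1)) \<in> G) \<noteq> ((2, q, Inr (H 2)) \<in> G))"

text \<open>Layer \<open>q\<close> sits at list position \<open>q - 1\<close>. The history at time
  \<open>t\<close> reads only slots before \<open>t\<close>, so the fed-back states suffice.\<close>

definition encoder :: "nat \<Rightarrow> schedule list \<Rightarrow> table list \<Rightarrow> nat \<Rightarrow> nat ^ 2 \<Rightarrow> (nat ^ 2) list \<Rightarrow> nat list" where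
  "encoder Q ts Gs t w ss = map (\<lambda>q. of_bool (coded_bit (ts ! t) (Gs ! t) w
     (\<lambda>u. history Q u (zip ss ts) Gs (w $ u) t) q)) [1..<Suc Q]"

lemma is_code_encoder: "is_code 2 Q n R (encoder Q ts Gs)"
  by (auto simp: is_code_def encoder_def)

lemma two_neq_plus_one [simp]: "(u :: 2) \<noteq> u + 1" "u + 1 \<noteq> u" "u + 1 + 1 = u"
  using exhaust_2[of u] by auto

text \<open>The numeral \<open>3\<close> arises when \<open>2 + 1\<close>, the partner of user
  \<open>2\<close>, is simplified.\<close>

lemma three_eq_one: "(3 :: 2) = 1"
  using exhaust_2[of "2 + 1"] two_neq_plus_one[of 2] by auto

text \<open>The two message vectors may also differ in the message of the other user. Equal outputs
  still force equal hashes of that user, so these cancel and only conditions on user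
  \<open>u\<close> remain.\<close>

lemma same_output_indists:
  assumes len: "length ss = n" "length ts = n" "length Gs = n"
    and eq: "user_output n (encoder Q ts Gs) u w ss = user_output n (encoder Q ts Gs) u w' ss"
  shows "indists Q u (w $ u) (w' $ u) [] [] (zip ss ts) Gs"
proof -
  define H where "H v w t = history Q v (zip ss ts) Gs (w $ v) t" for v t and w :: "nat ^ 2"
  have bit: "coded_bit (ts ! t) (Gs ! t) w (\<lambda>v. H v w t) q = coded_bit (ts ! t) (Gs ! t) w' (\<lambda>v. H v w' t) q"
    if "t < n" "q \<in> {1..Q}" "q \<le> ss ! t $ u" for t q
  proof -
    have "take (ss ! t $ u) (encoder Q ts Gs t w (take t ss)) = take (ss ! t $ u) (encoder Q ts Gs t w' (take t ss))"
      using eq \<open>t < n\<close> by (auto simp: user_output_def)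
    then have "encoder Q ts Gs t w (take t ss) ! (q - 1) = encoder Q ts Gs t w' (take t ss) ! (q - 1)"
      using that by (metis One_nat_def Suc_le_lessD Suc_pred' atLeastAtMost_iff less_eq_Suc_le nth_take)
    moreover have "history Q v (zip (take t ss) ts) Gs a t = history Q v (zip ss ts) Gs a t" for v a
      using len \<open>t < n\<close> by (auto simp: history_def)
    moreover have "q - 1 < length [1..<Suc Q]" "[1..<Suc Q] ! (q - 1) = q"
      using that by (auto simp del: upt_Suc)
    ultimately show ?thesis
      unfolding encoder_def H_def by (simp only: nth_map of_bool_eq_iff)
  qed
  \<comment> \<open>The bits of user \<open>u + 1\<close> recorded in this history are exactly ones
    that user \<open>u\<close> received uncoded, so equal outputs fix them.\<close>
  have other: "H (u + 1) w t = H (u + 1) w' t" if "t \<le> n" for t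
  proof -
    have "overheard Q (u + 1) (ss ! i, ts ! i) (Gs ! i) (w $ (u + 1)) = overheard Q (u + 1) (ss ! i, ts ! i) (Gs ! i) (w' $ (u + 1))"
      if "i < n" for i
    proof -
      have "(u + 1, q, Inl (w $ (u + 1))) \<in> Gs ! i \<longleftrightarrow> (u + 1, q, Inl (w' $ (u + 1))) \<in> Gs ! i"
        if "q \<in> {1..Q}" "q \<le> ss ! i $ u" "(ts ! i) q = Some (u + 1)" for q
        using bit[OF \<open>i < n\<close> that(1,2)] that(3) by (simp add: coded_bit_def)
      then show ?thesis
        by (auto simp: overheard_def)
    qed
    then show ?thesis
      using that len by (auto simp: H_def history_def)
  qed
  have "indist Q u (ss ! t, ts ! t) (Gs ! t) (w $ u) (w' $ u) (H u w t) (H u w' t)" if "t < n" for t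
  proof -
    have "(u, q, Inr (H u w t)) \<in> Gs ! t \<longleftrightarrow> (u, q, Inr (H u w' t)) \<in> Gs ! t"
      if "q \<in> {1..Q}" "q \<le> ss ! t $ u" "(ts ! t) q = None" for q
      using bit[OF \<open>t < n\<close> that(1,2)] other[of t] \<open>t < n\<close> that(3) exhaust_2[of u]
      by (auto simp: coded_bit_def three_eq_one)
    moreover have "(u, q, Inl (w $ u)) \<in> Gs ! t \<longleftrightarrow> (u, q, Inl (w' $ u)) \<in> Gs ! t"
      if "q \<in> {1..Q}" "q \<le> ss ! t $ u" "(ts ! t) q = Some u" for q
      using bit[OF \<open>t < n\<close> that(1,2)] that(3) by (auto simp: coded_bit_def)
    ultimately show ?thesis
      by (auto simp: indist_def)
  qed
  then show ?thesis
    using len by (subst indists_iff) (auto simp: H_def)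
qed

section \<open>Existence of good codes\<close>

lemma finite_vecs_less: "finite {w :: nat ^ 'k. \<forall>u. w $ u < f u}"
proof -
  have "{w :: nat ^ 'k. \<forall>u. w $ u < f u} \<subseteq> vec_lambda ` (PiE UNIV (\<lambda>u. {..<f u}))"
    by (auto simp: image_iff PiE_def Pi_def intro!: exI[where x = "vec_nth _"] vec_nth_inverse[symmetric])
  then show ?thesis
    by (rule finite_subset) (intro finite_imageI finite_PiE; simp)
qed

lemma finite_msgs: "finite (msgs qf n R)"
  unfolding msgs_def by (rule finite_vecs_less)

lemma msgs_nonempty: "msgs qf n R \<noteq> {}"
  by (auto simp: msgs_def msize_def intro!: exI[where x = "\<chi> i. 0"])

text \<open>Counting only the wrong messages absorbs the lower limit 1 in \<open>msize\<close>, so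
  the bound also holds for negative rates.\<close>

lemma msize_minus_one_le: "real (msize 2 n r - 1) \<le> 2 powr (real n * r)"
proof -
  have "real (nat \<lfloor>2 powr (real n * r)\<rfloor>) \<le> 2 powr (real n * r)"
    by simp
  moreover have "real (msize 2 n r - 1) \<le> real (nat \<lfloor>2 powr (real n * r)\<rfloor>)"
    unfolding msize_def by (intro of_nat_mono) (auto simp: max_def)
  ultimately show ?thesis
    by linarith
qed

text \<open>The bound holds for each message vector on average over random schedules and tables, so
  some fixed choice of both attains it on average over messages and states.\<close>

lemma exists_code:
  fixes P :: "(nat ^ 2) pmf" and R :: "real ^ 2"
  assumes s: "\<And>u. 0 < s u" "\<And>u. s u \<le> 1" and \<rho>: "\<And>u. 0 < \<rho> u"
    and A: "\<And>u. (\<integral>\<^sup>+x. ennreal (((1/2) ^ seen Q u x) powr s u) \<partial>measure_pmf (pair_pmf P T)) \<le> ennreal (\<rho> u)"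
    and B: "\<And>u. (\<integral>\<^sup>+x. ennreal (((1/2) ^ useful Q u x) powr s u) \<partial>measure_pmf (pair_pmf P T)) \<le> ennreal (\<rho> u)"
  shows "\<exists>enc dec. is_code 2 Q n R enc \<and> err_prob P 2 n R enc dec \<le>
    (\<Sum>u\<in>UNIV. (2 powr (real n * R $ u)) powr s u * ((1 + n / \<rho> u) * \<rho> u ^ n))"
proof -
  define m where "m u = msize 2 n (R $ u)" for u
  define Gp where "Gp = iid_pmf (pmf_of_set (Pow (keys Q (\<Sum>u\<in>UNIV. m u) n))) n"
  define W where "W = pmf_of_set (msgs 2 n R)"
  define C where "C = pair_pmf (iid_pmf T n) Gp"
  define X where "X = pair_pmf W (iid_pmf P n)"
  define bad where "bad w xs Gs \<longleftrightarrow> (\<exists>u. \<exists>a'<m u. a' \<noteq> w $ u \<and> indists Q u (w $ u) a' [] [] xs Gs)" for w xs Gs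
  define bound where "bound u = (2 powr (real n * R $ u)) powr s u * ((1 + n / \<rho> u) * \<rho> u ^ n)" for u
  have bound_nonneg: "bound u \<ge> 0" for u
    using \<rho>[of u] by (simp add: bound_def)
  have setW: "set_pmf W = msgs 2 n R"
    by (simp add: W_def finite_msgs msgs_nonempty)
  have Ew: "emeasure (measure_pmf (pair_pmf (iid_pmf (pair_pmf P T) n) Gp)) {(xs, Gs). bad w xs Gs} \<le> ennreal (\<Sum>u\<in>UNIV. bound u)"
    if "w \<in> msgs 2 n R" for w
  proof -
    let ?S = "\<lambda>u. {(xs, Gs). \<exists>a'<m u. a' \<noteq> w $ u \<and> indists Q u (w $ u) a' [] [] xs Gs}"
    have "{(xs, Gs). bad w xs Gs} = (\<Union>u\<in>UNIV. ?S u)"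
      by (auto simp: bad_def)
    then have "emeasure (measure_pmf (pair_pmf (iid_pmf (pair_pmf P T) n) Gp)) {(xs, Gs). bad w xs Gs} \<le>
        (\<Sum>u\<in>UNIV. emeasure (measure_pmf (pair_pmf (iid_pmf (pair_pmf P T) n) Gp)) (?S u))"
      by (simp only:) (rule emeasure_subadditive_finite; simp)
    also have "\<dots> \<le> (\<Sum>u\<in>UNIV. ennreal (bound u))"
    proof (rule sum_mono)
      fix u
      have "emeasure (measure_pmf (pair_pmf (iid_pmf (pair_pmf P T) n) Gp)) (?S u)
        \<le> ennreal (real (m u - 1) powr s u * ((1 + n / \<rho> u) * \<rho> u ^ n))"
        unfolding Gp_def using that
        by (intro prob_exists_confusable s \<rho> A B member_le_sum) (auto simp: msgs_def m_def)
      also have "\<dots> \<le> ennreal (bound u)"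
        unfolding bound_def m_def using msize_minus_one_le[of n "R $ u"] s[of u] \<rho>[of u]
        by (intro ennreal_leI mult_right_mono powr_mono2) auto
      finally show "emeasure (measure_pmf (pair_pmf (iid_pmf (pair_pmf P T) n) Gp)) (?S u) \<le> ennreal (bound u)" .
    qed
    also have "\<dots> = ennreal (\<Sum>u\<in>UNIV. bound u)"
      by (rule sum_ennreal) (rule bound_nonneg)
    finally show ?thesis .
  qed
  \<comment> \<open>Derandomization needs the code drawn first, the error bound needs the message
    fixed first; after the exchange, states and schedules merge into i.i.d. slots.\<close>
  have "emeasure (measure_pmf (pair_pmf C X)) {((ts, Gs), (w, ss)). bad w (zip ss ts) Gs}
      = emeasure (measure_pmf (pair_pmf X C)) {((w, ss), (ts, Gs)). bad w (zip ss ts) Gs}"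
    by (subst pair_commute_pmf) (auto simp: vimage_def intro!: arg_cong[where f = "emeasure _"])
  also have "\<dots> = (\<integral>\<^sup>+w. emeasure (measure_pmf (pair_pmf (iid_pmf (pair_pmf P T) n) Gp)) {(xs, Gs). bad w xs Gs} \<partial>measure_pmf W)"
    by (simp add: X_def C_def emeasure_pair_pmf nn_integral_pair_pmf' flip: iid_pmf_zip)
  also have "\<dots> \<le> (\<integral>\<^sup>+w. ennreal (\<Sum>u\<in>UNIV. bound u) \<partial>measure_pmf W)"
    by (intro nn_integral_mono_AE) (auto simp: AE_measure_pmf_iff setW intro!: Ew)
  also have "\<dots> = ennreal (\<Sum>u\<in>UNIV. bound u)"
    by (simp add: measure_pmf.emeasure_space_1[simplified])
  finally have "measure_pmf.prob (pair_pmf C X) {(c, x). case c of (ts, Gs) \<Rightarrow> case x of (w, ss) \<Rightarrow> bad w (zip ss ts) Gs}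
      \<le> (\<Sum>u\<in>UNIV. bound u)"
    by (simp add: measure_pmf.emeasure_eq_measure sum_nonneg bound_nonneg case_prod_unfold)
  from pair_pmf_exists_le[OF this] obtain ts Gs where
    tsGs: "(ts, Gs) \<in> set_pmf C" "measure_pmf.prob X {(w, ss). bad w (zip ss ts) Gs} \<le> (\<Sum>u\<in>UNIV. bound u)"
    by auto
  have len: "length ts = n" "length Gs = n"
    using tsGs(1) by (auto simp: C_def Gp_def length_iid_pmf)
  define enc where "enc = encoder Q ts Gs"
  \<comment> \<open>The decoder picks any message consistent with the output. The true one always
    qualifies, so an error exhibits a wrong consistent message.\<close>
  define dec where "dec u ys ss = (SOME a. \<exists>w'\<in>msgs 2 n R. w' $ u = a \<and> user_output n enc u w' ss = ys)"
    for u :: 2 and ys ss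
  have "bad w (zip ss ts) Gs"
    if w: "w \<in> msgs 2 n R" "length ss = n" and ne: "dec u (user_output n enc u w ss) ss \<noteq> w $ u" for w ss u
  proof -
    have "\<exists>w'\<in>msgs 2 n R. w' $ u = dec u (user_output n enc u w ss) ss \<and> user_output n enc u w' ss = user_output n enc u w ss"
      unfolding dec_def by (rule someI[of _ "w $ u"]) (use w(1) in blast)
    then obtain w' where w': "w' \<in> msgs 2 n R" "w' $ u \<noteq> w $ u" "user_output n enc u w ss = user_output n enc u w' ss"
      using ne by auto
    then have "indists Q u (w $ u) (w' $ u) [] [] (zip ss ts) Gs"
      using w(2) len by (intro same_output_indists) (auto simp: enc_def)
    then show ?thesis
      using w' by (auto simp: bad_def msgs_def m_def)
  qed
  then have "err_prob P 2 n R enc dec \<le> measure_pmf.prob X {(w, ss). bad w (zip ss ts) Gs}"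
    unfolding err_prob_def W_def[symmetric] X_def[symmetric]
    by (intro measure_pmf.finite_measure_mono_AE) (auto simp: AE_measure_pmf_iff X_def setW length_iid_pmf)
  then show ?thesis
    using tsGs(2) is_code_encoder unfolding bound_def enc_def by (meson order_trans)
qed

text \<open>For each user, one small \<open>s\<close> brings both moments below
  \<open>2 powr (- s * R $ u)\<close>; a \<open>\<rho>\<close> strictly in between makes the bound
  of \<open>exists_code\<close> decay geometrically up to a linear factor.\<close>

lemma achievable_of_expectation:
  fixes P :: "(nat ^ 2) pmf" and R :: "real ^ 2"
  assumes fin: "finite (set_pmf (pair_pmf P T))"
    and seen: "\<And>u. R $ u < measure_pmf.expectation (pair_pmf P T) (\<lambda>x. real (seen Q u x))"
    and useful: "\<And>u. R $ u < measure_pmf.expectation (pair_pmf P T) (\<lambda>x. real (useful Q u x))"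
  shows "achievable P Q R"
proof -
  let ?p = "pair_pmf P T"
  let ?A = "\<lambda>u s. measure_pmf.expectation ?p (\<lambda>x. ((1/2) ^ seen Q u x) powr s)"
  let ?B = "\<lambda>u s. measure_pmf.expectation ?p (\<lambda>x. ((1/2) ^ useful Q u x) powr s)"
  have "\<exists>s \<rho>. 0 < s \<and> s \<le> 1 \<and> 0 < \<rho> \<and> \<rho> < 2 powr (- s * R $ u) \<and> ?A u s \<le> \<rho> \<and> ?B u s \<le> \<rho>" for u
  proof -
    have "eventually (\<lambda>s::real. s > 0 \<and> s < 1) (at_right 0)"
      by (auto simp: eventually_at_right_field intro!: exI[of _ 1])
    from eventually_conj[OF expectation_powr_eventually_less[OF fin seen[of u]]
        eventually_conj[OF expectation_powr_eventually_less[OF fin useful[of u]] this]]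
    have "eventually (\<lambda>s. ?A u s < 2 powr (- s * R $ u) \<and> ?B u s < 2 powr (- s * R $ u) \<and> s > 0 \<and> s < 1) (at_right 0)" .
    then obtain s where s: "?A u s < 2 powr (- s * R $ u)" "?B u s < 2 powr (- s * R $ u)" "s > 0" "s < 1"
      using eventually_happens'[OF trivial_limit_at_right_real[of 0]] by blast
    \<comment> \<open>Including 0 in the maximum makes the chosen \<open>\<rho>\<close>
      positive.\<close>
    then have "max (?A u s) (max (?B u s) 0) < 2 powr (- s * R $ u)"
      by simp
    then obtain \<rho> where "max (?A u s) (max (?B u s) 0) < \<rho>" "\<rho> < 2 powr (- s * R $ u)"
      using dense by blast
    then have "0 < s \<and> s \<le> 1 \<and> 0 < \<rho> \<and> \<rho> < 2 powr (- s * R $ u) \<and> ?A u s \<le> \<rho> \<and> ?B u s \<le> \<rho>"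
      using s unfolding max_less_iff_conj by auto
    then show ?thesis by blast
  qed
  then obtain s \<rho> where s: "\<And>u. 0 < s u" "\<And>u. s u \<le> 1" and \<rho>: "\<And>u. 0 < \<rho> u"
    and \<rho>_less: "\<And>u. \<rho> u < 2 powr (- s u * R $ u)" and AB: "\<And>u. ?A u (s u) \<le> \<rho> u" "\<And>u. ?B u (s u) \<le> \<rho> u"
    by metis
  have nn: "(\<integral>\<^sup>+x. ennreal (((1/2) ^ k x) powr s u) \<partial>measure_pmf ?p)
      = ennreal (measure_pmf.expectation ?p (\<lambda>x. ((1/2) ^ k x) powr s u))" for k :: "slot \<Rightarrow> nat" and u
    using s(1)[of u]
    by (intro nn_integral_eq_integral measure_pmf.integrable_const_bound[where B = 1])
       (auto simp: power_le_one powr_le1)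
  have "\<exists>enc dec. is_code 2 Q n R enc \<and> err_prob P 2 n R enc dec \<le>
    (\<Sum>u\<in>UNIV. (2 powr (real n * R $ u)) powr s u * ((1 + n / \<rho> u) * \<rho> u ^ n))" for n
    by (rule exists_code[where T = T and s = s and \<rho> = \<rho>, OF s \<rho>]) (auto simp: nn AB intro!: ennreal_leI)
  then have "\<forall>n. \<exists>c. is_code 2 Q n R (fst c) \<and> err_prob P 2 n R (fst c) (snd c) \<le>
      (\<Sum>u\<in>UNIV. (2 powr (real n * R $ u)) powr s u * ((1 + n / \<rho> u) * \<rho> u ^ n))"
    by simp
  from choice[OF this] obtain c where c: "\<And>n. is_code 2 Q n R (fst (c n))"
      "\<And>n. err_prob P 2 n R (fst (c n)) (snd (c n)) \<le>
      (\<Sum>u\<in>UNIV. (2 powr (real n * R $ u)) powr s u * ((1 + n / \<rho> u) * \<rho> u ^ n))"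
    by blast
  define enc dec where "enc = (\<lambda>n. fst (c n))" and "dec = (\<lambda>n. snd (c n))"
  have code: "is_code 2 Q n R (enc n)"
    and err: "err_prob P 2 n R (enc n) (dec n) \<le>
      (\<Sum>u\<in>UNIV. (2 powr (real n * R $ u)) powr s u * ((1 + n / \<rho> u) * \<rho> u ^ n))" for n
    using c by (simp_all add: enc_def dec_def)
  have lim: "(\<lambda>n. (2 powr (real n * R $ u)) powr s u * ((1 + n / \<rho> u) * \<rho> u ^ n)) \<longlonglongrightarrow> 0" for u
  proof -
    define \<theta> where "\<theta> = 2 powr (s u * R $ u) * \<rho> u"
    have "\<theta> > 0" using \<rho>[of u] by (simp add: \<theta>_def)
    have "\<theta> < 1"
      using \<rho>_less[of u] by (simp add: \<theta>_def powr_minus field_simps)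
    have "(2 powr (real n * R $ u)) powr s u * ((1 + n / \<rho> u) * \<rho> u ^ n) = \<theta> ^ n + (1 / \<rho> u) * (real n * \<theta> ^ n)" for n
    proof -
      have "(2 powr (real n * R $ u)) powr s u = (2 powr (s u * R $ u)) ^ n"
        by (simp add: powr_powr powr_realpow[symmetric] mult_ac)
      then show ?thesis
        by (simp add: \<theta>_def power_mult_distrib algebra_simps)
    qed
    moreover have "(\<lambda>n. \<theta> ^ n + (1 / \<rho> u) * (real n * \<theta> ^ n)) \<longlonglongrightarrow> 0 + (1 / \<rho> u) * 0"
      using \<open>\<theta> > 0\<close> \<open>\<theta> < 1\<close> by (intro tendsto_intros LIMSEQ_power_zero powser_times_n_limit_0) auto
    ultimately show ?thesis by simp
  qed
  have "(\<lambda>n. \<Sum>u\<in>UNIV. (2 powr (real n * R $ u)) powr s u * ((1 + n / \<rho> u) * \<rho> u ^ n)) \<longlonglongrightarrow> (\<Sum>u\<in>(UNIV :: 2 set). 0)"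
    by (intro tendsto_sum lim)
  then have "(\<lambda>n. err_prob P 2 n R (enc n) (dec n)) \<longlonglongrightarrow> 0"
    unfolding sum.neutral_const
  proof (rule tendsto_sandwich[OF _ _ tendsto_const, rotated 2])
    show "\<forall>\<^sub>F n in sequentially. 0 \<le> err_prob P 2 n R (enc n) (dec n)"
      by (simp add: err_prob_def)
    show "\<forall>\<^sub>F n in sequentially. err_prob P 2 n R (enc n) (dec n) \<le>
        (\<Sum>u\<in>UNIV. (2 powr (real n * R $ u)) powr s u * ((1 + n / \<rho> u) * \<rho> u ^ n))"
      by (intro always_eventually allI err)
  qed
  moreover have "prime_power 2"
    unfolding prime_power_def by (intro exI[of _ 2] exI[of _ 1]) simp
  ultimately show ?thesis
    using code unfolding achievable_def by blast
qed

subsection \<open>Rates of the time-shared schedule\<close>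

lemma prob_pair_pmf_Times:
  "measure_pmf.prob (pair_pmf p r) {x. fst x \<in> A \<and> snd x \<in> B} = measure_pmf.prob p A * measure_pmf.prob r B"
proof -
  have "emeasure (measure_pmf (pair_pmf p r)) {x. fst x \<in> A \<and> snd x \<in> B}
      = (\<integral>\<^sup>+x. emeasure (measure_pmf r) B * indicator A x \<partial>measure_pmf p)"
    unfolding emeasure_pair_pmf by (intro nn_integral_cong) (auto split: split_indicator)
  also have "\<dots> = emeasure (measure_pmf r) B * emeasure (measure_pmf p) A"
    by (simp add: nn_integral_cmult)
  finally show ?thesis
    by (simp add: measure_pmf.emeasure_eq_measure mult.commute flip: ennreal_mult')
qed

lemma expectation_card:
  assumes "finite S"
  shows "measure_pmf.expectation p (\<lambda>x. real (card {q \<in> S. A q x})) = (\<Sum>q\<in>S. measure_pmf.prob p {x. A q x})"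
proof -
  have "real (card {q \<in> S. A q x}) = (\<Sum>q\<in>S. indicator {x. A q x} x)" for x
    using assms by (simp add: indicator_def sum.If_cases Int_def)
  then show ?thesis
    by (simp only:, subst Bochner_Integration.integral_sum)
      (auto intro: measure_pmf.integrable_const_bound[where B = 1])
qed

text \<open>State and schedule are independent, and reaching at least one of the two users is the
  event counted by \<open>pM\<close>, whichever user is \<open>u\<close>.\<close>

lemma expectation_seen:
  assumes "finite A" "{1..Q} \<subseteq> A"
  shows "measure_pmf.expectation (pair_pmf P (Pi_pmf A d \<tau>)) (\<lambda>x. real (seen Q u x)) = (\<Sum>q=1..Q. pM P q * pmf (\<tau> q) (Some u))"
proof -
  have "measure_pmf.prob (pair_pmf P (Pi_pmf A d \<tau>)) {x. snd x q = Some u \<and> (q \<le> fst x $ u \<or> q \<le> fst x $ (u + 1))}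
      = pM P q * pmf (\<tau> q) (Some u)" if "q \<in> {1..Q}" for q
  proof -
    have "{x. snd x q = Some u \<and> (q \<le> fst x $ u \<or> q \<le> fst x $ (u + 1))}
        = {x. fst x \<in> {N. q \<le> max (N $ 1) (N $ 2)} \<and> snd x \<in> (\<lambda>f. f q) -` {Some u}}"
      using exhaust_2[of u] by (auto simp: le_max_iff_disj three_eq_one)
    moreover have "measure_pmf.prob (Pi_pmf A d \<tau>) ((\<lambda>f. f q) -` {Some u}) = pmf (\<tau> q) (Some u)"
      using Pi_pmf_component[OF assms(1), of q d \<tau>] that assms(2)
      by (simp only: measure_map_pmf[symmetric]) (auto simp: measure_pmf_single)
    ultimately show ?thesis
      by (simp only: prob_pair_pmf_Times pM_def)
  qed
  then show ?thesis
    unfolding seen_def expectation_card[OF finite_atLeastAtMost] by (rule sum.cong[OF refl])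
qed

text \<open>Of the three kinds of schedule entry, only an uncoded bit of the other user is worthless
  to \<open>u\<close>.\<close>

lemma expectation_useful:
  assumes "finite A" "{1..Q} \<subseteq> A"
  shows "measure_pmf.expectation (pair_pmf P (Pi_pmf A d \<tau>)) (\<lambda>x. real (useful Q u x)) = (\<Sum>q=1..Q. pN P u q * (1 - pmf (\<tau> q) (Some (u + 1))))"
proof -
  have "measure_pmf.prob (pair_pmf P (Pi_pmf A d \<tau>)) {x. (snd x q = Some u \<or> snd x q = None) \<and> q \<le> fst x $ u}
      = pN P u q * (1 - pmf (\<tau> q) (Some (u + 1)))" if "q \<in> {1..Q}" for q
  proof -
    have "y = u \<or> y = u + 1" for y :: 2
      using exhaust_2[of u] exhaust_2[of y] by (auto simp: three_eq_one)
    then have "f q = Some u \<or> f q = None \<longleftrightarrow> f q \<noteq> Some (u + 1)" for f :: schedule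
      by (metis not_None_eq option.inject two_neq_plus_one(1) option.distinct(1))
    then have "{x. (snd x q = Some u \<or> snd x q = None) \<and> q \<le> fst x $ u}
        = {x. fst x \<in> {N. q \<le> N $ u} \<and> snd x \<in> (\<lambda>f. f q) -` (- {Some (u + 1)})}"
      by auto
    moreover have "measure_pmf.prob (Pi_pmf A d \<tau>) ((\<lambda>f. f q) -` (- {Some (u + 1)})) = 1 - pmf (\<tau> q) (Some (u + 1))"
      using Pi_pmf_component[OF assms(1), of q d \<tau>] that assms(2) measure_pmf.prob_compl[of "{Some (u + 1)}" "\<tau> q"]
      by (simp only: measure_map_pmf[symmetric]) (auto simp: measure_pmf_single Compl_eq_Diff_UNIV)
    ultimately show ?thesis
      by (simp only: prob_pair_pmf_Times pN_def)
  qed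
  then show ?thesis
    unfolding useful_def expectation_card[OF finite_atLeastAtMost] by (rule sum.cong[OF refl])
qed

text \<open>The tail-sum formula for the mean, truncated at \<open>Q\<close> by the bound on the
  states.\<close>

lemma EN_eq_sum_pN:
  assumes "\<forall>N \<in> set_pmf P. N $ u \<le> Q"
  shows "EN P u = (\<Sum>q=1..Q. pN P u q)"
proof -
  have "EN P u = measure_pmf.expectation P (\<lambda>N. real (card {q \<in> {1..Q}. q \<le> N $ u}))"
    unfolding EN_def
  proof (intro integral_cong_AE)
    have "{q \<in> {1..Q}. q \<le> k} = {1..k}" if "k \<le> Q" for k
      using that by auto
    then show "AE N in measure_pmf P. real (N $ u) = real (card {q \<in> {1..Q}. q \<le> N $ u})"
      using assms by (simp add: AE_measure_pmf_iff)
  qed auto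
  then show ?thesis
    using expectation_card[of "{1..Q}" P "\<lambda>q N. q \<le> N $ u"] by (simp add: pN_def)
qed

text \<open>Layers are scheduled independently: an uncoded bit of user \<open>u\<close> with
  probability \<open>\<alpha> u q\<close>, and network coding with the remaining
  probability.\<close>

lemma achievable_below:
  fixes P :: "(nat ^ 2) pmf" and \<alpha> :: "2 \<Rightarrow> nat \<Rightarrow> real"
  assumes bdd: "\<forall>N \<in> set_pmf P. \<forall>u. N $ u \<le> Q"
    and \<alpha>: "\<And>u q. q \<in> {1..Q} \<Longrightarrow> 0 \<le> \<alpha> u q" "\<And>q. q \<in> {1..Q} \<Longrightarrow> \<alpha> 1 q + \<alpha> 2 q \<le> 1"
    and R: "\<And>u. R $ u < (\<Sum>q=1..Q. pM P q * \<alpha> u q)" "\<And>u. R $ u < (\<Sum>q=1..Q. pN P u q * (1 - \<alpha> (u + 1) q))"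
  shows "achievable P Q R"
proof -
  define \<tau> :: "nat \<Rightarrow> 2 option pmf" where "\<tau> q = pmf_of_list [(Some 1, \<alpha> 1 q), (Some 2, \<alpha> 2 q), (None, 1 - \<alpha> 1 q - \<alpha> 2 q)]"
    for q
  define T where "T = Pi_pmf {1..Q} None \<tau>"
  have wf: "pmf_of_list_wf [(Some 1, \<alpha> 1 q), (Some 2, \<alpha> 2 q), (None, 1 - \<alpha> 1 q - \<alpha> 2 q)]" if "q \<in> {1..Q}" for q
    using \<alpha>(1)[OF that] \<alpha>(2)[OF that] by (auto simp: pmf_of_list_wf_def)
  have \<tau>: "pmf (\<tau> q) (Some u) = \<alpha> u q" if "q \<in> {1..Q}" for u q
    using exhaust_2[of u] by (auto simp: \<tau>_def pmf_pmf_of_list[OF wf[OF that]])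
  have "finite (set_pmf P)"
    by (rule finite_subset[OF _ finite_vecs_less[of "\<lambda>_. Suc Q"]]) (use bdd in \<open>auto simp: less_Suc_eq_le\<close>)
  moreover have "finite (set_pmf T)"
    unfolding T_def by (rule finite_subset[OF set_Pi_pmf_subset'])
      (auto simp: \<tau>_def intro!: finite_PiE_dflt finite_set_pmf_of_list wf)
  ultimately have "finite (set_pmf (pair_pmf P T))"
    by simp
  then show ?thesis
  proof (rule achievable_of_expectation)
    fix u
    show "R $ u < measure_pmf.expectation (pair_pmf P T) (\<lambda>x. real (seen Q u x))"
      using R(1)[of u] by (simp add: T_def expectation_seen \<tau>)
    show "R $ u < measure_pmf.expectation (pair_pmf P T) (\<lambda>x. real (useful Q u x))"
      using R(2)[of u] by (simp add: T_def expectation_useful \<tau>)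
  qed
qed

theorem theorem2:
  fixes P :: "(nat ^ 2) pmf" and Q :: nat
  assumes "Q \<ge> 1"
    and "\<forall>N \<in> set_pmf P. \<forall>u. N $ u \<le> Q"
    and "\<forall>q \<in> {1..Q}. pM P q > 0"
    and "\<forall>u. EN P u > 0"
  shows "C_in P Q \<subseteq> capacity_region P Q"
proof
  fix R assume "R \<in> C_in P Q"
  then obtain t k where t: "t > 0" and k: "\<And>u q. 0 \<le> k u q" and le: "t_unc P Q k + t_NC P Q k \<le> t"
    and R: "\<And>u. R $ u = (\<Sum>q=1..Q. k u q) / t"
    by (auto simp: C_in_def)
  define \<alpha> where "\<alpha> u q = k u q / (pM P q * t)" for u q
  have EN_pos: "EN P u > 0" for u
    using assms(4) by simp
  have NC: "k_rem P Q k u / EN P u \<le> t_NC P Q k" for u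
    using exhaust_2[of u] by (auto simp: t_NC_def t_NC_u_def)
  have NC_nonneg: "t_NC P Q k \<ge> 0"
    using NC[of 1] EN_pos[of 1] by (simp add: k_rem_def) (meson divide_nonneg_pos max.cobounded1 order_trans)
  have unc: "t_unc_q P k q \<le> t_unc P Q k" if "q \<in> {1..Q}" for q
    unfolding t_unc_def using that by (intro Max_ge) auto
  have \<alpha>_sum: "\<alpha> 1 q + \<alpha> 2 q = t_unc_q P k q / t" for q
    by (simp add: \<alpha>_def t_unc_q_def add_divide_distrib)
  have other: "\<alpha> u q + \<alpha> (u + 1) q = t_unc_q P k q / t" for u q
    using exhaust_2[of u] \<alpha>_sum[of q] by (auto simp: three_eq_one)
  have useful: "R $ u \<le> (\<Sum>q=1..Q. pN P u q * (1 - \<alpha> (u + 1) q))" for u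
  proof -
    have "(\<Sum>q=1..Q. k_rem_q P k u q - (t_unc P Q k - t_unc_q P k q) * pN P u q) \<le> k_rem P Q k u"
      by (simp add: k_rem_def)
    also have "\<dots> \<le> t_NC P Q k * EN P u"
      using NC[of u] EN_pos[of u] by (simp add: field_simps)
    also have "\<dots> \<le> (t - t_unc P Q k) * EN P u"
      using le EN_pos[of u] by (intro mult_right_mono) auto
    also have "\<dots> = (\<Sum>q=1..Q. (t - t_unc P Q k) * pN P u q)"
      using assms(2) by (subst EN_eq_sum_pN[of P u Q]) (auto simp: sum_distrib_left)
    finally have "0 \<le> (\<Sum>q=1..Q. (t - t_unc P Q k) * pN P u q - (k_rem_q P k u q - (t_unc P Q k - t_unc_q P k q) * pN P u q))"
      by (simp add: sum_subtractf)
    \<comment> \<open>The terms in \<open>t_unc\<close> cancel. Substituting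
      \<open>k u q / pM P q = t * \<alpha> u q\<close> and the value of \<open>t_unc_q\<close>
      leaves only the share \<open>\<alpha> (u + 1) q\<close> of the other user.\<close>
    also have "\<dots> = (\<Sum>q=1..Q. t * (pN P u q * (1 - \<alpha> (u + 1) q)) - k u q)"
    proof (rule sum.cong[OF refl])
      fix q assume "q \<in> {1..Q}"
      then have "pM P q > 0" using assms(3) by simp
      then have "k u q = t * pM P q * \<alpha> u q"
        using t by (simp add: \<alpha>_def)
      moreover have "t_unc_q P k q = t * (\<alpha> u q + \<alpha> (u + 1) q)"
        using other[of u q] t by simp
      ultimately show "(t - t_unc P Q k) * pN P u q - (k_rem_q P k u q - (t_unc P Q k - t_unc_q P k q) * pN P u q)
          = t * (pN P u q * (1 - \<alpha> (u + 1) q)) - k u q"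
        using \<open>pM P q > 0\<close> by (simp add: k_rem_q_def field_simps)
    qed
    finally have "(\<Sum>q=1..Q. k u q) \<le> t * (\<Sum>q=1..Q. pN P u q * (1 - \<alpha> (u + 1) q))"
      by (simp only: sum_subtractf sum_distrib_left[symmetric] diff_ge_0_iff_ge)
    then show ?thesis
      using t by (simp add: R divide_le_eq mult.commute)
  qed
  have seen: "R $ u = (\<Sum>q=1..Q. pM P q * \<alpha> u q)" for u
  proof -
    have "pM P q * \<alpha> u q = k u q / t" if "q \<in> {1..Q}" for q
      using bspec[OF assms(3) that] by (simp add: \<alpha>_def)
    then show ?thesis by (simp add: R sum_divide_distrib)
  qed
  \<comment> \<open>The mean number of seen bits equals the rate exactly, whereas
    \<open>achievable_below\<close> needs strict inequalities; lowering the rates slightly gives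
    them, and the closure recovers \<open>R\<close>.\<close>
  define R' where "R' n = (\<chi> u. R $ u - 1 / real (Suc n))" for n
  have "achievable P Q (R' n)" for n
  proof (rule achievable_below[OF assms(2), of \<alpha>])
    fix u q assume q: "q \<in> {1..Q}"
    show "0 \<le> \<alpha> u q"
      using k[of u q] t assms(3) q by (auto simp: \<alpha>_def intro!: divide_nonneg_pos)
    show "\<alpha> 1 q + \<alpha> 2 q \<le> 1"
      using unc[OF q] le NC_nonneg t by (simp add: \<alpha>_sum)
  next
    fix u
    have "R' n $ u < R $ u"
      by (simp add: R'_def)
    then show "R' n $ u < (\<Sum>q=1..Q. pM P q * \<alpha> u q)" "R' n $ u < (\<Sum>q=1..Q. pN P u q * (1 - \<alpha> (u + 1) q))"
      using seen[of u] useful[of u] by auto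
  qed
  then have "R' n \<in> convex hull {R. achievable P Q R}" for n
    by (simp add: hull_inc)
  moreover have "R' \<longlonglongrightarrow> R"
  proof (rule vec_tendstoI)
    fix u
    have "(\<lambda>n. R $ u - 1 / real (Suc n)) \<longlonglongrightarrow> R $ u - 0"
      by (intro tendsto_intros LIMSEQ_Suc[OF lim_1_over_n])
    then show "(\<lambda>n. R' n $ u) \<longlonglongrightarrow> R $ u"
      by (simp add: R'_def)
  qed
  ultimately show "R \<in> capacity_region P Q"
    unfolding capacity_region_def closure_sequential by blast
qed

end
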